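(* Let $P$ be the uniform distribution on the unit circle $x_1^2+x_2^2=1$ in $\mathbb{R}^2$. Then the quantization dimension of $P$ exists and equals the dimension of the circle, $$D(P)=\lim_{n\to\infty}\frac{2\log n}{-\log V_n(P)}=1,$$ and moreover $$\lim_{n\to\infty}n^2V_n(P)=\frac{\pi^2}{3},$$ which is a finite positive number.
   Context: The uniform distribution $P$ on the unit circle is the Borel probability measure on $\mathbb{R}^2$ supported on the circle given by normalized arc length, i.e. the image of $\frac{1}{2\pi}d\theta$ on $[0,2\pi]$ under $\theta\mapsto(\cos\theta,\sin\theta)$. For a Borel probability measure $P$ on $\mathbb{R}^d$ (here $d=2$) with $\int\|x\|^2dP(x)<\infty$ and a nonempty finite set $\alpha\subset\mathbb{R}^d$, put $V(P;\alpha)=\int\min_{c\in\alpha}\|x-c\|^2\,dP(x)$, with $\|\cdot\|$ the Euclidean norm. The $n$th quantization error is $V_n(P)=\inf\{V(P;\alpha):\alpha\subset\mathbb{R}^d,\ 1\le\operatorname{card}(\alpha)\leq n\}$. The lower and upper quantization dimensions are the $\liminf$ and $\limsup$ as $n\to\infty$ of $\frac{2\log n}{-\log V_n(P)}$; if they are equal, the common value is the quantization dimension $D(P)$. *)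

theory Defs
  imports "HOL-Probability.Probability"
begin

definition uniform_circle :: "(real^2) measure" where
  "uniform_circle =
     distr (uniform_measure lborel {0..2 * pi}) borel (\<lambda>\<theta>. vector [cos \<theta>, sin \<theta>])"

text \<open>The next three definitions are meant for Borel probability measures with finite second
  moment. The distortion integrand is then integrable for every nonempty finite \<open>\<alpha>\<close>, and the
  infimum in the quantization error is that of a nonempty set bounded below whenever \<open>n \<ge> 1\<close>;
  the value at \<open>n = 0\<close> is irrelevant to the limits below.\<close>

definition distortion :: "'a::euclidean_space measure \<Rightarrow> 'a set \<Rightarrow> real" where
  "distortion P \<alpha> = (LINT x|P. Min ((\<lambda>c. (norm (x - c))\<^sup>2) ` \<alpha>))"

definition quantization_error :: "'a::euclidean_space measure \<Rightarrow> nat \<Rightarrow> real" where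
  "quantization_error P n =
     Inf (distortion P ` {\<alpha>. finite \<alpha> \<and> 1 \<le> card \<alpha> \<and> card \<alpha> \<le> n})"

text \<open>By the conventions \<open>ln 0 = 0\<close> and \<open>x / 0 = 0\<close> this ratio is \<open>0\<close> when the error is \<open>0\<close>
  (which agrees with reading \<open>- ln 0\<close> as infinity) and when the error is \<open>1\<close>.\<close>

definition quantization_ratio :: "'a::euclidean_space measure \<Rightarrow> nat \<Rightarrow> real" where
  "quantization_ratio P n = 2 * ln (real n) / (- ln (quantization_error P n))"

definition lower_quantization_dimension :: "'a::euclidean_space measure \<Rightarrow> ereal" where
  "lower_quantization_dimension P = liminf (\<lambda>n. ereal (quantization_ratio P n))"

definition upper_quantization_dimension :: "'a::euclidean_space measure \<Rightarrow> ereal" where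
  "upper_quantization_dimension P = limsup (\<lambda>n. ereal (quantization_ratio P n))"

definition quantization_dimension_exists :: "'a::euclidean_space measure \<Rightarrow> bool" where
  "quantization_dimension_exists P \<longleftrightarrow>
     lower_quantization_dimension P = upper_quantization_dimension P"

text \<open>Unspecified when the lower and upper dimensions differ.\<close>

definition quantization_dimension :: "'a::euclidean_space measure \<Rightarrow> ereal" where
  "quantization_dimension P =
     (THE D. lower_quantization_dimension P = D \<and> upper_quantization_dimension P = D)"

lemma sets_uniform_circle: "sets uniform_circle = sets borel"
  by (simp add: uniform_circle_def)

lemma measurable_circle_param:
  "(\<lambda>\<theta>. vector [cos \<theta>, sin \<theta>] :: real^2) \<in> borel_measurable (uniform_measure lborel {0..2 * pi})"
proof -
  have "continuous_on UNIV (\<lambda>\<theta>. vector [cos \<theta>, sin \<theta>] :: real^2)"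
    by (subst continuous_on_componentwise)
       (auto simp: Basis_vec_def inner_axis forall_2 vector_2 exhaust_2 intro!: continuous_intros
         dest: exhaust_2[THEN disjE])
  then show ?thesis
    by (subst measurable_cong_sets[OF sets_uniform_measure refl])
       (simp add: borel_measurable_continuous_onI)
qed

lemma prob_space_uniform_circle: "prob_space uniform_circle"
  unfolding uniform_circle_def
  by (intro prob_space.prob_space_distr prob_space_uniform_measure measurable_circle_param)
     auto

lemma AE_uniform_circle: "AE x in uniform_circle. (x $ 1)\<^sup>2 + (x $ 2)\<^sup>2 = 1"
  unfolding uniform_circle_def
  by (subst AE_distr_iff[OF measurable_circle_param]) (auto simp: vector_2)

lemma integrable_uniform_circle: "integrable uniform_circle (\<lambda>x. (norm x)\<^sup>2)"
proof -
  interpret prob_space uniform_circle by (rule prob_space_uniform_circle)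
  have "AE x in uniform_circle. norm ((norm x)\<^sup>2) \<le> 1"
    using AE_uniform_circle
    by eventually_elim (simp add: norm_vec_def L2_set_def sum_2)
  moreover have "(\<lambda>x. (norm x)\<^sup>2) \<in> borel_measurable uniform_circle"
    by (simp add: measurable_cong_sets[OF sets_uniform_circle refl])
  ultimately show ?thesis
    by (intro integrable_const_bound[where B = 1]) auto
qed

end

theory Submission
  imports Defs "HOL-Real_Asymp.Real_Asymp"
begin

text \<open>
  Write \<open>h = \<pi> / n\<close> and let \<open>e \<theta>\<close> be the point of the unit circle at angle \<open>\<theta>\<close>. The proof encloses
  the quantization error \<open>V n\<close> between two explicit functions of \<open>h\<close> that are both asymptotic to
  \<open>h\<^sup>2 / 3\<close>.

  For the upper bound (\<open>quantization_error_circle_le\<close>), take \<open>n\<close> equally spaced points \<^emph>\<open>on\<close> the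
  circle. The optimal centres lie slightly inside the circle, but using the circle itself
  changes the error only in the order \<open>h\<^sup>4\<close>, which the limits do not see.

  For the lower bound (\<open>quantization_error_circle_ge\<close>), no geometry of Voronoi cells is needed.
  For any threshold \<open>G\<close> and any finite family of costs, \<open>min\<^sub>c g\<^sub>c \<ge> G - \<Sum>\<^sub>c max 0 (G - g\<^sub>c)\<close>, so it is enough to
  bound from above what a single centre \<open>c\<close> can save below the threshold. The squared distance
  from \<open>e \<theta>\<close> to \<open>c\<close> is at least the squared distance to the ray through \<open>c\<close>, and rotating that ray
  does not change the integral (\<open>saving_of_centre_le\<close>). The threshold \<open>G = sin\<^sup>2 h\<close> is chosen such
  that a ray saves exactly on the arc of half-width \<open>h\<close> around it. Since \<open>n\<close> such arcs can tile the
  circle, adding up the savings as if the arcs never overlapped is sharp to leading order.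

  Since \<open>n\<^sup>2 V n\<close> then has a finite positive limit, \<open>- ln (V n) = 2 ln n + O(1)\<close>, which gives the
  dimension.
\<close>

section \<open>Integrals over the circle\<close>

definition circle_point :: "real \<Rightarrow> real^2" where
  "circle_point \<theta> = vector [cos \<theta>, sin \<theta>]"

lemma norm_circle_point_diff:
  "(norm (circle_point \<theta> - c))\<^sup>2 = (cos \<theta> - c $ 1)\<^sup>2 + (sin \<theta> - c $ 2)\<^sup>2"
  by (simp add: circle_point_def norm_vec_def L2_set_def sum_2)

lemma norm_circle_point_diff_polar:
  assumes "c $ 1 = \<rho> * cos \<phi>" "c $ 2 = \<rho> * sin \<phi>"
  shows "(norm (circle_point \<theta> - c))\<^sup>2 = 1 + \<rho>\<^sup>2 - 2 * \<rho> * cos (\<theta> - \<phi>)"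
proof -
  have expand: "(a - \<rho> * x)\<^sup>2 + (b - \<rho> * y)\<^sup>2
      = (b\<^sup>2 + a\<^sup>2) + \<rho>\<^sup>2 * (y\<^sup>2 + x\<^sup>2) - 2 * \<rho> * (a * x + b * y)" for a b x y :: real
    by (simp add: power2_eq_square algebra_simps)
  show ?thesis
    unfolding norm_circle_point_diff assms expand cos_diff by simp
qed

lemma polar_coordinates:
  fixes c :: "real^2"
  obtains \<rho> \<phi> where "0 \<le> \<rho>" "0 \<le> \<phi>" "\<phi> < 2 * pi" "c $ 1 = \<rho> * cos \<phi>" "c $ 2 = \<rho> * sin \<phi>"
proof (cases "c = 0")
  case True
  then show ?thesis using that[of 0 0] by simp
next
  case False
  define \<rho> where "\<rho> = norm c"
  have \<rho>: "\<rho> > 0" using False by (simp add: \<rho>_def)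
  have sq: "\<rho>\<^sup>2 = (c $ 1)\<^sup>2 + (c $ 2)\<^sup>2"
    by (simp add: \<rho>_def norm_vec_def L2_set_def sum_2)
  have "(c $ 1 / \<rho>)\<^sup>2 + (c $ 2 / \<rho>)\<^sup>2 = ((c $ 1)\<^sup>2 + (c $ 2)\<^sup>2) / \<rho>\<^sup>2"
    by (simp add: power_divide add_divide_distrib)
  also have "\<dots> = 1"
    unfolding sq[symmetric] using \<rho> by simp
  finally have "(c $ 1 / \<rho>)\<^sup>2 + (c $ 2 / \<rho>)\<^sup>2 = 1" .
  then obtain \<phi> where "0 \<le> \<phi>" "\<phi> < 2 * pi" "c $ 1 / \<rho> = cos \<phi>" "c $ 2 / \<rho> = sin \<phi>"
    by (rule sincos_total_2pi)
  then show ?thesis using \<rho> by (intro that[of \<rho> \<phi>]) (auto simp: field_simps)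
qed

lemma continuous_on_Min_image:
  fixes f :: "'b \<Rightarrow> 'a::topological_space \<Rightarrow> 'c::linorder_topology"
  assumes "finite A" "A \<noteq> {}" "\<And>c. c \<in> A \<Longrightarrow> continuous_on S (f c)"
  shows "continuous_on S (\<lambda>x. Min ((\<lambda>c. f c x) ` A))"
  using assms
proof (induction A rule: finite_ne_induct)
  case (insert a A)
  then have "continuous_on S (\<lambda>x. min (f a x) (Min ((\<lambda>c. f c x) ` A)))"
    by (intro continuous_on_min) auto
  with insert.hyps show ?case by simp
qed simp

lemma integral_uniform_circle:
  fixes f :: "real^2 \<Rightarrow> real"
  assumes "continuous_on UNIV f"
  shows "(LINT x|uniform_circle. f x) = integral {0..2 * pi} (\<lambda>\<theta>. f (circle_point \<theta>)) / (2 * pi)"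
proof -
  let ?g = "\<lambda>\<theta>. f (circle_point \<theta>)"
  have m: "circle_point \<in> borel_measurable lborel"
    using measurable_circle_param
    by (simp add: circle_point_def[abs_def] measurable_cong_sets[OF sets_uniform_measure refl])
  have f: "f \<in> borel_measurable borel"
    using assms by (rule borel_measurable_continuous_onI)
  have g: "?g \<in> borel_measurable lborel"
    using m f by (rule measurable_compose)
  have cp: "continuous_on UNIV circle_point"
    unfolding circle_point_def[abs_def]
    by (subst continuous_on_componentwise)
       (auto simp: Basis_vec_def inner_axis forall_2 vector_2 exhaust_2 intro!: continuous_intros
         dest: exhaust_2[THEN disjE])
  have "continuous_on {0..2 * pi} ?g"
    by (rule continuous_on_subset[OF continuous_on_compose2[OF assms cp]]) auto
  then have i: "set_integrable lborel {0..2 * pi} ?g"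
    by (rule borel_integrable_atLeastAtMost')
  have dens: "uniform_measure lborel {0..2 * pi}
      = density lborel (\<lambda>x. ennreal (indicator {0..2 * pi} x / (2 * pi)))"
    unfolding uniform_measure_def
    by (intro density_cong) (auto split: split_indicator simp: divide_ennreal[symmetric]
       simp flip: ennreal_1)
  have "(LINT x|uniform_circle. f x) = (LINT \<theta>|uniform_measure lborel {0..2 * pi}. ?g \<theta>)"
    unfolding uniform_circle_def circle_point_def
    by (intro integral_distr measurable_circle_param f)
  also have "\<dots> = (LINT \<theta>|lborel. (indicator {0..2 * pi} \<theta> / (2 * pi)) *\<^sub>R ?g \<theta>)"
    unfolding dens by (intro integral_density g) auto
  also have "\<dots> = (LINT \<theta>:{0..2 * pi}|lborel. ?g \<theta>) / (2 * pi)"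
    by (simp add: set_lebesgue_integral_def)
  also have "\<dots> = integral {0..2 * pi} ?g / (2 * pi)"
    using set_borel_integral_eq_integral(2)[OF i] by simp
  finally show ?thesis .
qed

lemma distortion_uniform_circle:
  assumes "finite \<alpha>" "\<alpha> \<noteq> {}"
  shows "distortion uniform_circle \<alpha>
    = integral {0..2 * pi} (\<lambda>\<theta>. Min ((\<lambda>c. (norm (circle_point \<theta> - c))\<^sup>2) ` \<alpha>)) / (2 * pi)"
  unfolding distortion_def
  by (intro integral_uniform_circle continuous_on_Min_image[OF assms] continuous_intros)

lemma continuous_on_distance_to_centre:
  "continuous_on S (\<lambda>\<theta>. (norm (circle_point \<theta> - c))\<^sup>2)"
  unfolding norm_circle_point_diff by (intro continuous_intros)

lemma continuous_on_distance_to_centres: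
  assumes "finite \<alpha>" "\<alpha> \<noteq> {}"
  shows "continuous_on S (\<lambda>\<theta>. Min ((\<lambda>c. (norm (circle_point \<theta> - c))\<^sup>2) ` \<alpha>))"
  by (intro continuous_on_Min_image[OF assms] continuous_on_distance_to_centre)

section \<open>Lower bound for the quantization error\<close>

lemma integral_period_shift:
  fixes f :: "real \<Rightarrow> real"
  assumes f: "continuous_on UNIV f" and per: "\<And>t. f (t + T) = f t"
    and ab: "a \<le> b" "b \<le> a + T"
  shows "integral {a..a + T} f = integral {b..b + T} f"
proof -
  have int: "f integrable_on {u..v}" for u v
    by (intro integrable_continuous_real continuous_on_subset[OF f]) auto
  have "integral {a..b} f = integral {a + T..b + T} f"
    using integral_shift_real_ivl[of "a + T" T "b + T" f] by (simp add: per)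
  moreover have "integral {a..b} f + integral {b..a + T} f = integral {a..a + T} f"
    using ab by (intro Henstock_Kurzweil_Integration.integral_combine int) auto
  moreover have "integral {b..a + T} f + integral {a + T..b + T} f = integral {b..b + T} f"
    using ab by (intro Henstock_Kurzweil_Integration.integral_combine int) auto
  ultimately show ?thesis by simp
qed

text \<open>Half-wave rectification encodes the distance to a ray: the closest point of the ray at angle
  \<open>0\<close> to \<open>circle_point t\<close> is at distance \<open>\<bar>sin t\<bar>\<close> in the half-plane where \<open>cos t \<ge> 0\<close>, and is the
  origin otherwise. So this is the saving below the threshold \<open>sin\<^sup>2 h\<close>.\<close>

definition ray_saving :: "real \<Rightarrow> real \<Rightarrow> real" where
  "ray_saving h t = max 0 ((max 0 (cos t))\<^sup>2 - (cos h)\<^sup>2)"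

lemma continuous_on_ray_saving: "continuous_on S (ray_saving h)"
  unfolding ray_saving_def[abs_def] by (intro continuous_intros)

lemma integral_ray_saving:
  assumes h: "0 \<le> h" "h \<le> pi / 2"
  shows "integral {-pi..pi} (ray_saving h) = h + sin h * cos h - 2 * h * (cos h)\<^sup>2"
proof -
  have ch: "cos h \<ge> 0" using h by (intro cos_ge_zero) auto
  have zero: "ray_saving h t = 0" if "h \<le> \<bar>t\<bar>" "\<bar>t\<bar> \<le> pi" for t
  proof -
    have "cos \<bar>t\<bar> \<le> cos h" using that h by (intro cos_monotone_0_pi_le) auto
    then have "max 0 (cos t) \<le> cos h" using ch by simp
    then have "(max 0 (cos t))\<^sup>2 \<le> (cos h)\<^sup>2" by (intro power_mono) auto
    then show ?thesis by (simp add: ray_saving_def)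
  qed
  have pos: "ray_saving h t = (cos t)\<^sup>2 - (cos h)\<^sup>2" if "t \<in> {-h..h}" for t
  proof -
    have "cos h \<le> cos \<bar>t\<bar>" using that h by (intro cos_monotone_0_pi_le) auto
    then have "cos h \<le> cos t" by simp
    with ch have "max 0 (cos t) = cos t" "(cos h)\<^sup>2 \<le> (cos t)\<^sup>2"
      by (auto intro: power_mono)
    then show ?thesis by (simp add: ray_saving_def)
  qed
  have int: "ray_saving h integrable_on {u..v}" for u v
    by (intro integrable_continuous_real continuous_on_ray_saving)
  define F where "F = (\<lambda>t. t / 2 + sin t * cos t / 2 - t * (cos h)\<^sup>2)"
  have deriv: "(F has_vector_derivative (cos t)\<^sup>2 - (cos h)\<^sup>2) (at t within {-h..h})" for t
  proof -
    have "(F has_real_derivative 1/2 + (cos t * cos t - sin t * sin t) / 2 - (cos h)\<^sup>2)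
        (at t within {-h..h})"
      unfolding F_def by (auto intro!: derivative_eq_intros simp: field_simps)
    moreover have "1/2 + (cos t * cos t - sin t * sin t) / 2 = (cos t)\<^sup>2"
      using sin_cos_squared_add[of t] by (simp add: power2_eq_square field_simps)
    ultimately show ?thesis by (simp add: has_real_derivative_iff_has_vector_derivative)
  qed
  have "((\<lambda>t. (cos t)\<^sup>2 - (cos h)\<^sup>2) has_integral F h - F (-h)) {-h..h}"
    using h by (intro fundamental_theorem_of_calculus deriv) auto
  then have mid: "integral {-h..h} (ray_saving h) = F h - F (-h)"
    using pos by (subst integral_cong[OF pos]) (auto intro: integral_unique)
  have "integral {-pi..-h} (ray_saving h) = integral {-pi..-h} (\<lambda>_. 0)"
    using h by (intro integral_cong zero) auto
  moreover have "integral {h..pi} (ray_saving h) = integral {h..pi} (\<lambda>_. 0)"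
    using h by (intro integral_cong zero) auto
  moreover have "integral {-pi..-h} (ray_saving h) + integral {-h..pi} (ray_saving h)
      = integral {-pi..pi} (ray_saving h)"
    using h pi_gt_zero by (intro Henstock_Kurzweil_Integration.integral_combine int) linarith+
  moreover have "integral {-h..h} (ray_saving h) + integral {h..pi} (ray_saving h)
      = integral {-h..pi} (ray_saving h)"
    using h pi_gt_zero by (intro Henstock_Kurzweil_Integration.integral_combine int) linarith+
  ultimately show ?thesis using mid by (simp add: F_def algebra_simps)
qed

lemma integral_rotated_ray_saving:
  assumes "0 \<le> \<phi>" "\<phi> \<le> 2 * pi"
  shows "integral {0..2 * pi} (\<lambda>\<theta>. ray_saving h (\<theta> - \<phi>)) = integral {-pi..pi} (ray_saving h)"
proof -
  have per: "ray_saving h (t + 2 * pi) = ray_saving h t" for t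
    by (simp add: ray_saving_def)
  have "integral {-\<phi>..-\<phi> + 2 * pi} (ray_saving h) = integral {-pi..-pi + 2 * pi} (ray_saving h)"
  proof (cases "\<phi> \<le> pi")
    case True
    then show ?thesis
      using assms by (intro integral_period_shift[symmetric] continuous_on_ray_saving per) auto
  next
    case False
    then show ?thesis
      using assms by (intro integral_period_shift continuous_on_ray_saving per) auto
  qed
  moreover have "integral {0..2 * pi} (\<lambda>\<theta>. ray_saving h (\<theta> - \<phi>))
      = integral {-\<phi>..-\<phi> + 2 * pi} (ray_saving h)"
    using integral_shift_real_ivl[of "-\<phi>" "-\<phi>" "-\<phi> + 2 * pi" "ray_saving h"] by simp
  ultimately show ?thesis by simp
qed

text \<open>A centre saves at most as much as the whole ray from the origin through it.\<close>

lemma saving_of_centre_le: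
  assumes h: "0 \<le> h" "h \<le> pi / 2"
  shows "integral {0..2 * pi} (\<lambda>\<theta>. max 0 ((sin h)\<^sup>2 - (norm (circle_point \<theta> - c))\<^sup>2))
    \<le> h + sin h * cos h - 2 * h * (cos h)\<^sup>2"
proof -
  obtain \<rho> \<phi> where \<rho>: "0 \<le> \<rho>" and \<phi>: "0 \<le> \<phi>" "\<phi> < 2 * pi"
    and c: "c $ 1 = \<rho> * cos \<phi>" "c $ 2 = \<rho> * sin \<phi>"
    by (rule polar_coordinates)
  have le: "max 0 ((sin h)\<^sup>2 - (norm (circle_point \<theta> - c))\<^sup>2) \<le> ray_saving h (\<theta> - \<phi>)" for \<theta>
  proof -
    define u where "u = cos (\<theta> - \<phi>)"
    have "1 - (max 0 u)\<^sup>2 \<le> 1 + \<rho>\<^sup>2 - 2 * \<rho> * u"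
    proof (cases "u \<ge> 0")
      case True
      have "0 \<le> (\<rho> - u)\<^sup>2" by simp
      with True show ?thesis by (simp add: power2_diff)
    next
      case False
      then have "2 * \<rho> * u \<le> 0" using \<rho> by (simp add: mult_nonneg_nonpos)
      then have "2 * \<rho> * u \<le> \<rho>\<^sup>2" by (rule order_trans) simp
      moreover have "max 0 u = 0" using False by simp
      ultimately show ?thesis by simp
    qed
    then show ?thesis
      unfolding norm_circle_point_diff_polar[OF c] ray_saving_def u_def[symmetric] sin_squared_eq
      by auto
  qed
  have "integral {0..2 * pi} (\<lambda>\<theta>. max 0 ((sin h)\<^sup>2 - (norm (circle_point \<theta> - c))\<^sup>2))
      \<le> integral {0..2 * pi} (\<lambda>\<theta>. ray_saving h (\<theta> - \<phi>))"
    by (intro integral_le integrable_continuous_real le continuous_intros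
        continuous_on_distance_to_centre continuous_on_compose2[OF continuous_on_ray_saving]) auto
  also have "\<dots> = h + sin h * cos h - 2 * h * (cos h)\<^sup>2"
    using integral_rotated_ray_saving[of \<phi> h] integral_ray_saving[OF h] \<phi> by simp
  finally show ?thesis .
qed

lemma Min_ge_threshold_minus_savings:
  fixes g :: "'a \<Rightarrow> real"
  assumes "finite A" "A \<noteq> {}"
  shows "G - (\<Sum>c\<in>A. max 0 (G - g c)) \<le> Min (g ` A)"
proof -
  have "Min (g ` A) \<in> g ` A" using assms by (intro Min_in) auto
  then obtain a where a: "a \<in> A" "Min (g ` A) = g a" by auto
  have "max 0 (G - g a) \<le> (\<Sum>c\<in>A. max 0 (G - g c))"
    using assms a by (intro member_le_sum) auto
  with a show ?thesis by linarith
qed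

text \<open>With \<open>n \<ge> 2\<close> the half-width \<open>h\<close> is at most \<open>\<pi> / 2\<close>, so that the arc on which a ray saves stays in
  the half-plane where the distance to the ray is \<open>\<bar>sin t\<bar>\<close>.\<close>

lemma distortion_circle_ge:
  assumes n: "n \<ge> 2" and \<alpha>: "finite \<alpha>" "\<alpha> \<noteq> {}" "card \<alpha> \<le> n"
  defines "h \<equiv> pi / real n"
  shows "1/2 - sin h * cos h / (2 * h) \<le> distortion uniform_circle \<alpha>"
proof -
  have h: "0 < h" using n by (simp add: h_def)
  have h2: "h \<le> pi / 2"
    unfolding h_def by (rule divide_left_mono) (use n in auto)
  have nh: "real n * h = pi" using n by (simp add: h_def)
  define s where "s = (\<lambda>c \<theta>. max 0 ((sin h)\<^sup>2 - (norm (circle_point \<theta> - c))\<^sup>2))"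
  define B where "B = h + sin h * cos h - 2 * h * (cos h)\<^sup>2"
  have cont: "continuous_on S (s c)" for S c
    unfolding s_def by (intro continuous_intros continuous_on_distance_to_centre)
  have int: "s c integrable_on {0..2 * pi}" for c
    by (intro integrable_continuous_real cont)
  have sB: "integral {0..2 * pi} (s c) \<le> B" for c
    unfolding s_def B_def using h h2 by (intro saving_of_centre_le) auto
  have "0 \<le> integral {0..2 * pi} (s 0)"
    by (intro integral_nonneg int) (auto simp: s_def)
  with sB[of 0] have B0: "0 \<le> B" by linarith
  have "(\<Sum>c\<in>\<alpha>. integral {0..2 * pi} (s c)) \<le> real (card \<alpha>) * B"
    using sum_bounded_above[of \<alpha> "\<lambda>c. integral {0..2 * pi} (s c)" B] sB by simp
  also have "\<dots> \<le> real n * B"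
    using \<alpha> B0 by (intro mult_right_mono) auto
  finally have total: "(\<Sum>c\<in>\<alpha>. integral {0..2 * pi} (s c)) \<le> real n * B" .
  have "2 * pi * (sin h)\<^sup>2 - (\<Sum>c\<in>\<alpha>. integral {0..2 * pi} (s c))
      = integral {0..2 * pi} (\<lambda>\<theta>. (sin h)\<^sup>2 - (\<Sum>c\<in>\<alpha>. s c \<theta>))"
    using \<alpha> int by (subst integral_diff) (auto simp: integral_sum intro!: integrable_sum)
  also have "\<dots> \<le> integral {0..2 * pi} (\<lambda>\<theta>. Min ((\<lambda>c. (norm (circle_point \<theta> - c))\<^sup>2) ` \<alpha>))"
  proof (rule integral_le)
    show "(\<lambda>\<theta>. (sin h)\<^sup>2 - (\<Sum>c\<in>\<alpha>. s c \<theta>)) integrable_on {0..2 * pi}"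
      by (intro integrable_continuous_real continuous_intros cont)
    show "(\<lambda>\<theta>. Min ((\<lambda>c. (norm (circle_point \<theta> - c))\<^sup>2) ` \<alpha>)) integrable_on {0..2 * pi}"
      by (intro integrable_continuous_real continuous_on_distance_to_centres \<alpha>)
    show "(sin h)\<^sup>2 - (\<Sum>c\<in>\<alpha>. s c \<theta>) \<le> Min ((\<lambda>c. (norm (circle_point \<theta> - c))\<^sup>2) ` \<alpha>)" for \<theta>
      unfolding s_def by (rule Min_ge_threshold_minus_savings[OF \<alpha>(1,2)])
  qed
  also have "\<dots> = 2 * pi * distortion uniform_circle \<alpha>"
    by (simp add: distortion_uniform_circle[OF \<alpha>(1,2)])
  finally have "2 * pi * (sin h)\<^sup>2 - real n * B \<le> 2 * pi * distortion uniform_circle \<alpha>"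
    using total by linarith
  moreover have "2 * pi * (sin h)\<^sup>2 - real n * B = 2 * pi * (1/2 - sin h * cos h / (2 * h))"
  proof -
    have "real n * B = real n * h * (1 + sin h * cos h / h - 2 * (cos h)\<^sup>2)"
      using h by (simp add: B_def field_simps)
    then show ?thesis
      unfolding nh sin_squared_eq using h by (simp add: field_simps)
  qed
  ultimately show ?thesis by simp
qed

lemma quantization_error_circle_ge:
  assumes "n \<ge> 2"
  defines "h \<equiv> pi / real n"
  shows "1/2 - sin h * cos h / (2 * h) \<le> quantization_error uniform_circle n"
  unfolding quantization_error_def
proof (rule cInf_greatest)
  have "{0} \<in> {\<alpha> :: (real^2) set. finite \<alpha> \<and> 1 \<le> card \<alpha> \<and> card \<alpha> \<le> n}"
    using assms by auto
  then show "distortion uniform_circle ` {\<alpha>. finite \<alpha> \<and> 1 \<le> card \<alpha> \<and> card \<alpha> \<le> n} \<noteq> {}"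
    by blast
next
  fix v assume "v \<in> distortion uniform_circle ` {\<alpha>. finite \<alpha> \<and> 1 \<le> card \<alpha> \<and> card \<alpha> \<le> n}"
  then show "1/2 - sin h * cos h / (2 * h) \<le> v"
    using distortion_circle_ge[OF assms(1)] unfolding h_def by fastforce
qed

section \<open>Upper bound for the quantization error\<close>

lemma quantization_error_circle_le:
  assumes n: "n \<ge> 1"
  defines "h \<equiv> pi / real n"
  shows "quantization_error uniform_circle n \<le> 2 - 2 * sin h / h"
proof -
  have h: "0 < h" using n by (simp add: h_def)
  have nh: "real n * h = pi" using n by (simp add: h_def)
  define p where "p = (\<lambda>k::nat. circle_point ((2 * real k + 1) * h))"
  define \<alpha> where "\<alpha> = p ` {..<n}"
  have \<alpha>: "finite \<alpha>" "\<alpha> \<noteq> {}" using n by (auto simp: \<alpha>_def lessThan_empty_iff)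
  have card: "1 \<le> card \<alpha>" "card \<alpha> \<le> n"
    using \<alpha> card_image_le[of "{..<n}" p] by (auto simp: \<alpha>_def Suc_le_eq card_gt_0_iff)
  define m where "m = (\<lambda>\<theta>. Min ((\<lambda>c. (norm (circle_point \<theta> - c))\<^sup>2) ` \<alpha>))"
  have int: "m integrable_on {u..v}" for u v
    unfolding m_def by (intro integrable_continuous_real continuous_on_distance_to_centres \<alpha>)
  have piece: "integral {2 * real k * h..2 * real (Suc k) * h} m \<le> 4 * h - 4 * sin h"
    if "k < n" for k
  proof -
    define \<phi> where "\<phi> = (2 * real k + 1) * h"
    have dist: "m \<theta> \<le> 2 - 2 * cos (\<theta> - \<phi>)" for \<theta>
    proof -
      have "m \<theta> \<le> (norm (circle_point \<theta> - p k))\<^sup>2"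
        unfolding m_def using \<alpha> that by (intro Min_le) (auto simp: \<alpha>_def)
      also have "\<dots> = 2 - 2 * cos (\<theta> - \<phi>)"
        by (subst norm_circle_point_diff_polar[of _ 1 \<phi>]) (simp_all add: p_def circle_point_def \<phi>_def)
      finally show ?thesis .
    qed
    let ?F = "\<lambda>\<theta>. 2 * \<theta> - 2 * sin (\<theta> - \<phi>)"
    have ends: "2 * real k * h = \<phi> - h" "2 * real (Suc k) * h = \<phi> + h"
      by (simp_all add: \<phi>_def algebra_simps)
    have "((\<lambda>\<theta>. 2 - 2 * cos (\<theta> - \<phi>)) has_integral ?F (\<phi> + h) - ?F (\<phi> - h)) {\<phi> - h..\<phi> + h}"
      using h by (intro fundamental_theorem_of_calculus)
        (auto intro!: derivative_eq_intros simp flip: has_real_derivative_iff_has_vector_derivative)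
    then have F: "((\<lambda>\<theta>. 2 - 2 * cos (\<theta> - \<phi>)) has_integral 4 * h - 4 * sin h) {\<phi> - h..\<phi> + h}"
      by simp
    show ?thesis
      unfolding ends by (rule has_integral_le[OF integrable_integral[OF int] F dist])
  qed
  have "integral {0..2 * real k * h} m \<le> real k * (4 * h - 4 * sin h)" if "k \<le> n" for k
    using that
  proof (induction k)
    case (Suc k)
    have "integral {0..2 * real k * h} m + integral {2 * real k * h..2 * real (Suc k) * h} m
        = integral {0..2 * real (Suc k) * h} m"
      using h by (intro Henstock_Kurzweil_Integration.integral_combine int) (auto intro!: mult_right_mono)
    with Suc piece[of k] show ?case by (simp add: algebra_simps)
  qed simp
  from this[of n] have "integral {0..2 * pi} m \<le> real n * (4 * h - 4 * sin h)"
    using nh by (simp add: mult.assoc)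
  also have "\<dots> = real n * h * (4 - 4 * sin h / h)"
    using h by (simp add: field_simps)
  also have "\<dots> = 2 * pi * (2 - 2 * sin h / h)"
    unfolding nh by (simp add: algebra_simps)
  finally have "distortion uniform_circle \<alpha> \<le> 2 - 2 * sin h / h"
    unfolding distortion_uniform_circle[OF \<alpha>] m_def[symmetric]
    by (simp add: pos_divide_le_eq mult.commute)
  moreover have "quantization_error uniform_circle n \<le> distortion uniform_circle \<alpha>"
    unfolding quantization_error_def
  proof (rule cInf_lower)
    show "distortion uniform_circle \<alpha>
        \<in> distortion uniform_circle ` {\<alpha>. finite \<alpha> \<and> 1 \<le> card \<alpha> \<and> card \<alpha> \<le> n}"
      using \<alpha> card by auto
    have "0 \<le> distortion uniform_circle \<beta>" if "finite \<beta>" "1 \<le> card \<beta>" for \<beta>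
    proof -
      from that have "\<beta> \<noteq> {}" by auto
      then show ?thesis
        unfolding distortion_def using that
        by (intro integral_nonneg_AE AE_I2) simp
    qed
    then show "bdd_below (distortion uniform_circle ` {\<alpha>. finite \<alpha> \<and> 1 \<le> card \<alpha> \<and> card \<alpha> \<le> n})"
      by (intro bdd_belowI[of _ 0]) auto
  qed
  ultimately show ?thesis by linarith
qed

section \<open>Asymptotics\<close>

lemma quantization_coefficient_circle:
  "(\<lambda>n. (real n)\<^sup>2 * quantization_error uniform_circle n) \<longlonglongrightarrow> pi\<^sup>2 / 3"
proof (rule real_tendsto_sandwich)
  show "(\<lambda>n. (real n)\<^sup>2 * (1/2 - sin (pi / real n) * cos (pi / real n) / (2 * (pi / real n))))
      \<longlonglongrightarrow> pi\<^sup>2 / 3"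
    by (real_asymp simp: field_simps power2_eq_square)
  show "(\<lambda>n. (real n)\<^sup>2 * (2 - 2 * sin (pi / real n) / (pi / real n))) \<longlonglongrightarrow> pi\<^sup>2 / 3"
    by (real_asymp simp: field_simps power2_eq_square)
  show "\<forall>\<^sub>F n in sequentially.
      (real n)\<^sup>2 * (1/2 - sin (pi / real n) * cos (pi / real n) / (2 * (pi / real n)))
        \<le> (real n)\<^sup>2 * quantization_error uniform_circle n"
    using eventually_ge_at_top[of 2]
    by eventually_elim (intro mult_left_mono quantization_error_circle_ge, auto)
  show "\<forall>\<^sub>F n in sequentially. (real n)\<^sup>2 * quantization_error uniform_circle n
        \<le> (real n)\<^sup>2 * (2 - 2 * sin (pi / real n) / (pi / real n))"
    using eventually_ge_at_top[of 1]
    by eventually_elim (intro mult_left_mono quantization_error_circle_le, auto)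
qed

text \<open>A quadratic rate of decay with any positive constant forces dimension one: the constant only
  contributes a bounded term to \<open>- ln (V n)\<close>, next to \<open>2 ln n\<close>.\<close>

lemma log_ratio_of_quadratic_decay:
  fixes V :: "nat \<Rightarrow> real"
  assumes lim: "(\<lambda>n. (real n)\<^sup>2 * V n) \<longlonglongrightarrow> L" and L: "L > 0"
  shows "(\<lambda>n. 2 * ln (real n) / (- ln (V n))) \<longlonglongrightarrow> 1"
proof -
  have ln_lim: "(\<lambda>n. ln ((real n)\<^sup>2 * V n)) \<longlonglongrightarrow> ln L"
    using L by (intro tendsto_ln[OF lim]) auto
  have "(\<lambda>n. inverse (2 * ln (real n))) \<longlonglongrightarrow> 0"
    by real_asymp
  from tendsto_mult[OF ln_lim this]
  have "(\<lambda>n. ln ((real n)\<^sup>2 * V n) * inverse (2 * ln (real n))) \<longlonglongrightarrow> 0" by simp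
  then have "(\<lambda>n. 1 / (1 - ln ((real n)\<^sup>2 * V n) * inverse (2 * ln (real n)))) \<longlonglongrightarrow> 1 / (1 - 0)"
    by (intro tendsto_divide tendsto_diff tendsto_const) auto
  then have "(\<lambda>n. 1 / (1 - ln ((real n)\<^sup>2 * V n) * inverse (2 * ln (real n)))) \<longlonglongrightarrow> 1" by simp
  moreover have "\<forall>\<^sub>F n in sequentially. 1 / (1 - ln ((real n)\<^sup>2 * V n) * inverse (2 * ln (real n)))
      = 2 * ln (real n) / (- ln (V n))"
    using order_tendstoD(1)[OF lim L] eventually_ge_at_top[of 2]
  proof eventually_elim
    case (elim n)
    then have V: "V n > 0" by (simp add: zero_less_mult_iff)
    have "ln (real n) > 0" using elim by simp
    moreover have "ln ((real n)\<^sup>2 * V n) = 2 * ln (real n) + ln (V n)"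
      using V elim by (simp add: ln_mult ln_realpow)
    ultimately show ?case by (simp add: divide_simps)
  qed
  ultimately show ?thesis by (rule Lim_transform_eventually)
qed

lemma quantization_dimension_eqI:
  assumes "quantization_ratio P \<longlonglongrightarrow> D"
  shows "quantization_dimension_exists P" "quantization_dimension P = ereal D"
proof -
  have lim: "(\<lambda>n. ereal (quantization_ratio P n)) \<longlonglongrightarrow> ereal D" using assms by simp
  have "lower_quantization_dimension P = ereal D" "upper_quantization_dimension P = ereal D"
    unfolding lower_quantization_dimension_def upper_quantization_dimension_def
    using lim_imp_Liminf[OF _ lim] lim_imp_Limsup[OF _ lim] by auto
  then show "quantization_dimension_exists P" "quantization_dimension P = ereal D"
    by (auto simp: quantization_dimension_exists_def quantization_dimension_def)
qed

theorem mainTheorem6: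
  shows "quantization_dimension_exists uniform_circle
    \<and> quantization_dimension uniform_circle = 1
    \<and> (\<lambda>n. 2 * ln (real n) / (- ln (quantization_error uniform_circle n))) \<longlonglongrightarrow> 1
    \<and> (\<lambda>n. (real n)\<^sup>2 * quantization_error uniform_circle n) \<longlonglongrightarrow> pi\<^sup>2 / 3
    \<and> 0 < pi\<^sup>2 / 3"
proof -
  have ratio: "(\<lambda>n. 2 * ln (real n) / (- ln (quantization_error uniform_circle n))) \<longlonglongrightarrow> 1"
    by (rule log_ratio_of_quadratic_decay[OF quantization_coefficient_circle]) simp
  then have "quantization_ratio uniform_circle \<longlonglongrightarrow> 1"
    by (simp add: quantization_ratio_def[abs_def])
  from quantization_dimension_eqI[OF this] ratio quantization_coefficient_circle
  show ?thesis by (simp add: one_ereal_def)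
qed

end
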